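(* The bisimulation collapse of a LLEE-chart is again a LLEE-chart.
   Context: **Charts.** A chart is a tuple $\mathcal{C}=\langle V,\sqrt{},v_s,A,T\rangle$ with $V$ a finite set of vertices; $\sqrt{}$ a special symbol which, if $\sqrt{}\in V$, is a vertex without outgoing transitions indicating termination; $v_s\in V\setminus\{\sqrt{}\}$ the start vertex; $A$ a set of actions; $T\subseteq V\times A\times V$ a finite set of transitions, written $v\xrightarrow{a}v'$. Every vertex is reachable from $v_s$. **Bisimulation collapse.** Vertices $w_1,w_2$ of $\mathcal{C}$ are bisimilar if $w_1\,R\,w_2$ for some $R\subseteq V\times V$ such that whenever $v_1\,R\,v_2$: every $v_1\xrightarrow{a}v_1'$ is matched by some $v_2\xrightarrow{a}v_2'$ with $v_1'\,R\,v_2'$, every $v_2\xrightarrow{a}v_2'$ is matched by some $v_1\xrightarrow{a}v_1'$ with $v_1'\,R\,v_2'$, and $v_1=\sqrt{}$ iff $v_2=\sqrt{}$. The bisimulation collapse of $\mathcal{C}$ is the quotient chart of $\mathcal{C}$ under bisimilarity of vertices (unique up to isomorphism): its vertices are the bisimilarity classes, the class of $\sqrt{}$ (if $\sqrt{}\in V$) is its termination vertex, the class of $v_s$ is its start vertex, and $[v]\xrightarrow{a}[v']$ is a transition iff $v_1\xrightarrow{a}v_1'$ for some $v_1\in[v]$, $v_1'\in[v']$. **Loop charts.** A chart is a loop chart if (L1) there is an infinite path from its start vertex; (L2) every infinite path from its start vertex returns to the start vertex after a positive number of transitions; (L3) $\sqrt{}$ is not one of its vertices. **LLEE-witness.** An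 entry/body-labeling $\hat{\mathcal{C}}$ of $\mathcal{C}$ assigns to each transition of $\mathcal{C}$ a marking label in $\mathbb{N}$. Transitions with marking label $0$ are body transitions; transitions with marking label $\alpha\ge 1$ are entry transitions of level $\alpha$. For a vertex $v$ and $\alpha\geq1$ such that an entry transition of level $\alpha$ departs from $v$, let $\mathcal{C}_{\hat{\mathcal{C}}}(v,\alpha)$ be the subchart of $\mathcal{C}$ with start vertex $v$ consisting of the vertices and transitions that occur on paths which start with an entry transition of level $\alpha$ from $v$, continue with body transitions only, and halt immediately if $v$ is revisited. $\hat{\mathcal{C}}$ is a LLEE-witness of $\mathcal{C}$ if: (W1) there is no infinite path of body transitions from $v_s$; (W2) for every such pair $(v,\alpha)$: (a) $\mathcal{C}_{\hat{\mathcal{C}}}(v,\alpha)$ is a loop chart, and (b) from no vertex $w\ne v$ of $\mathcal{C}_{\hat{\mathcal{C}}}(v,\alpha)$ there departs an entry transition of level $\beta\ge\alpha$. A LLEE-chart is a chart that has a LLEE-witness. *)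

theory Defs
  imports Main
begin

type_synonym ('v, 'a) transition = "'v \<times> 'a \<times> 'v"

abbreviation source :: "('v, 'a) transition \<Rightarrow> 'v" where
  "source t \<equiv> fst t"

abbreviation target :: "('v, 'a) transition \<Rightarrow> 'v" where
  "target t \<equiv> snd (snd t)"

(* tick is the termination symbol; it need not be a vertex *)
record ('v, 'a) pre_chart =
  verts :: "'v set"
  tick :: 'v
  start :: 'v
  acts :: "'a set"
  transitions :: "('v, 'a) transition set"

definition chart :: "('v, 'a) pre_chart \<Rightarrow> bool" where
  "chart C \<longleftrightarrow>
     finite (verts C) \<and>
     start C \<in> verts C - {tick C} \<and>
     transitions C \<subseteq> verts C \<times> acts C \<times> verts C \<and>
     finite (transitions C) \<and>
     (\<forall>t \<in> transitions C. source t \<noteq> tick C) \<and>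
     (\<forall>v \<in> verts C. (start C, v) \<in> {(u, w). \<exists>a. (u, a, w) \<in> transitions C}\<^sup>*)"


definition bisimulation :: "('v, 'a) pre_chart \<Rightarrow> ('v \<times> 'v) set \<Rightarrow> bool" where
  "bisimulation C R \<longleftrightarrow>
     R \<subseteq> verts C \<times> verts C \<and>
     (\<forall>(v\<^sub>1, v\<^sub>2) \<in> R.
        (\<forall>a v\<^sub>1'. (v\<^sub>1, a, v\<^sub>1') \<in> transitions C \<longrightarrow> (\<exists>v\<^sub>2'. (v\<^sub>2, a, v\<^sub>2') \<in> transitions C \<and> (v\<^sub>1', v\<^sub>2') \<in> R)) \<and>
        (\<forall>a v\<^sub>2'. (v\<^sub>2, a, v\<^sub>2') \<in> transitions C \<longrightarrow> (\<exists>v\<^sub>1'. (v\<^sub>1, a, v\<^sub>1') \<in> transitions C \<and> (v\<^sub>1', v\<^sub>2') \<in> R)) \<and>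
        (v\<^sub>1 = tick C \<longleftrightarrow> v\<^sub>2 = tick C))"

definition bisimilarity :: "('v, 'a) pre_chart \<Rightarrow> ('v \<times> 'v) set" where
  "bisimilarity C = {(w\<^sub>1, w\<^sub>2). \<exists>R. bisimulation C R \<and> (w\<^sub>1, w\<^sub>2) \<in> R}"

(* If tick C is not a vertex, then its image under bisimilarity is the empty set, which is not a
   bisimilarity class, so that the termination symbol of the collapse is not a vertex either. *)
definition bisim_collapse :: "('v, 'a) pre_chart \<Rightarrow> ('v set, 'a) pre_chart" where
  "bisim_collapse C =
     \<lparr> verts = verts C // bisimilarity C,
       tick = bisimilarity C `` {tick C},
       start = bisimilarity C `` {start C},
       acts = acts C,
       transitions = {(X, a, Y). X \<in> verts C // bisimilarity C \<and> Y \<in> verts C // bisimilarity C \<and>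
                                 (\<exists>v \<in> X. \<exists>v' \<in> Y. (v, a, v') \<in> transitions C)} \<rparr>"


fun path :: "('v, 'a) pre_chart \<Rightarrow> 'v \<Rightarrow> ('v, 'a) transition list \<Rightarrow> bool" where
  "path C v [] \<longleftrightarrow> True"
| "path C v (t # ts) \<longleftrightarrow> t \<in> transitions C \<and> source t = v \<and> path C (target t) ts"

definition inf_path :: "('v, 'a) pre_chart \<Rightarrow> 'v \<Rightarrow> (nat \<Rightarrow> ('v, 'a) transition) \<Rightarrow> bool" where
  "inf_path C v p \<longleftrightarrow>
     source (p 0) = v \<and> (\<forall>i. p i \<in> transitions C \<and> source (p (Suc i)) = target (p i))"

definition loop_chart :: "('v, 'a) pre_chart \<Rightarrow> bool" where
  "loop_chart C \<longleftrightarrow>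
     chart C \<and>
     (\<exists>p. inf_path C (start C) p) \<and>
     (\<forall>p. inf_path C (start C) p \<longrightarrow> (\<exists>i. target (p i) = start C)) \<and>
     tick C \<notin> verts C"


(* Only the values on transitions of the chart under consideration matter. *)
type_synonym ('v, 'a) labeling = "('v, 'a) transition \<Rightarrow> nat"

definition entry_departs ::
  "('v, 'a) pre_chart \<Rightarrow> ('v, 'a) labeling \<Rightarrow> 'v \<Rightarrow> nat \<Rightarrow> bool" where
  "entry_departs C L v \<alpha> \<longleftrightarrow> \<alpha> \<ge> 1 \<and> (\<exists>t \<in> transitions C. source t = v \<and> L t = \<alpha>)"

(* The last conjunct is the requirement to halt as soon as v is revisited. Paths are not required
   to be maximal: this does not affect which vertices and transitions occur on them. *)
definition entry_path ::
  "('v, 'a) pre_chart \<Rightarrow> ('v, 'a) labeling \<Rightarrow> 'v \<Rightarrow> nat \<Rightarrow> ('v, 'a) transition list \<Rightarrow> bool" where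
  "entry_path C L v \<alpha> ts \<longleftrightarrow>
     path C v ts \<and> ts \<noteq> [] \<and>
     L (hd ts) = \<alpha> \<and> (\<forall>t \<in> set (tl ts). L t = 0) \<and>
     (\<forall>t \<in> set (butlast ts). target t \<noteq> v)"

definition entry_subchart ::
  "('v, 'a) pre_chart \<Rightarrow> ('v, 'a) labeling \<Rightarrow> 'v \<Rightarrow> nat \<Rightarrow> ('v, 'a) pre_chart" where
  "entry_subchart C L v \<alpha> =
     (let T = {t. \<exists>ts. entry_path C L v \<alpha> ts \<and> t \<in> set ts}
      in \<lparr> verts = source ` T \<union> target ` T, tick = tick C, start = v, acts = acts C, transitions = T \<rparr>)"

definition LLEE_witness :: "('v, 'a) pre_chart \<Rightarrow> ('v, 'a) labeling \<Rightarrow> bool" where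
  "LLEE_witness C L \<longleftrightarrow>
     \<not> (\<exists>p. inf_path C (start C) p \<and> (\<forall>i. L (p i) = 0)) \<and>
     (\<forall>v \<in> verts C. \<forall>\<alpha>. entry_departs C L v \<alpha> \<longrightarrow>
        loop_chart (entry_subchart C L v \<alpha>) \<and>
        (\<forall>w \<in> verts (entry_subchart C L v \<alpha>) - {v}. \<not> (\<exists>\<beta> \<ge> \<alpha>. entry_departs C L w \<beta>)))"

definition LLEE_chart :: "('v, 'a) pre_chart \<Rightarrow> bool" where
  "LLEE_chart C \<longleftrightarrow> chart C \<and> (\<exists>L. LLEE_witness C L)"

end

theory Submission imports Defs begin

text \<open>
  Call a transition from \<open>v\<close> to \<open>w\<close> of a set \<open>H\<close> of transitions \<^emph>\<open>escaping\<close> if within \<open>H\<close> one can,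
  starting at \<open>w\<close> and without visiting \<open>v\<close>, run forever or reach the termination vertex. An
  \<^emph>\<open>obstruction\<close> is a set of transitions that contains an infinite path and all of whose transitions
  are escaping. A chart is a LLEE-chart iff it has no obstruction: an entry transition of least level
  in an obstruction cannot be escaping, and conversely loop entries can be eliminated greedily,
  always at vertices outside the loops eliminated before, until no infinite path is left. Escapes
  lift along the projection to the collapse, so the preimage of an obstruction of the collapse is
  an obstruction of the chart.
\<close>

section \<open>Escapes, obstructions and loop interiors\<close>

definition steps :: "('v, 'a) transition set \<Rightarrow> ('v \<times> 'v) set" where
  "steps H = {(u, w). \<exists>a. (u, a, w) \<in> H}"

text \<open>Only the source of a step is kept away from \<open>v\<close>, so a path may end in
  \<open>v\<close> but not continue through it. This mirrors the rule to halt when \<open>v\<close>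
  is revisited.\<close>

definition steps_avoiding :: "('v, 'a) transition set \<Rightarrow> 'v \<Rightarrow> ('v \<times> 'v) set" where
  "steps_avoiding H v = {(u, w) \<in> steps H. u \<noteq> v}"

definition perpetual :: "('v, 'a) transition set \<Rightarrow> 'v set \<Rightarrow> bool" where
  "perpetual H S \<longleftrightarrow> (\<forall>u\<in>S. \<exists>a w. (u, a, w) \<in> H \<and> w \<in> S)"

definition surviving :: "'v \<Rightarrow> ('v, 'a) transition set \<Rightarrow> 'v set \<Rightarrow> bool" where
  "surviving k H S \<longleftrightarrow> (\<forall>u\<in>S. u = k \<or> (\<exists>a w. (u, a, w) \<in> H \<and> w \<in> S))"

text \<open>Infinite paths and paths to \<open>k\<close> are both encoded by the set of vertices that they visit.\<close>

definition escapes :: "'v \<Rightarrow> ('v, 'a) transition set \<Rightarrow> 'v \<Rightarrow> 'v \<Rightarrow> bool" where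
  "escapes k H v w \<longleftrightarrow> (\<exists>S. w \<in> S \<and> v \<notin> S \<and> surviving k H S)"

definition obstruction :: "('v, 'a) pre_chart \<Rightarrow> ('v, 'a) transition set \<Rightarrow> bool" where
  "obstruction C H \<longleftrightarrow>
     H \<subseteq> transitions C \<and> (\<exists>S. S \<noteq> {} \<and> perpetual H S) \<and>
     (\<forall>v a w. (v, a, w) \<in> H \<longrightarrow> escapes (tick C) H v w)"

definition body :: "('v, 'a) pre_chart \<Rightarrow> ('v, 'a) labeling \<Rightarrow> ('v, 'a) transition set" where
  "body C L = {t \<in> transitions C. L t = 0}"

text \<open>This is the vertex set of the entry subchart of \<open>v\<close> at level
  \<open>\<alpha>\<close> without \<open>v\<close> itself, written with reachability in place of
  lists of transitions.\<close>

definition interior :: "('v, 'a) pre_chart \<Rightarrow> ('v, 'a) labeling \<Rightarrow> 'v \<Rightarrow> nat \<Rightarrow> 'v set" where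
  "interior C L v \<alpha> = {u. u \<noteq> v \<and>
     (\<exists>a w. (v, a, w) \<in> transitions C \<and> L (v, a, w) = \<alpha> \<and>
            (w, u) \<in> (steps_avoiding (body C L) v)\<^sup>*)}"

section \<open>Basic facts on infinite paths, escapes and avoidance of a vertex\<close>

lemma perpetual_inf_path:
  assumes "perpetual H S" "v \<in> S"
  obtains p where "source (p 0) = v" "\<And>i. p i \<in> H"
    "\<And>i. source (p (Suc i)) = target (p i)" "\<And>i. source (p i) \<in> S"
proof -
  define f where "f u = (SOME t. t \<in> H \<and> source t = u \<and> target t \<in> S)" for u
  have f: "f u \<in> H \<and> source (f u) = u \<and> target (f u) \<in> S" if "u \<in> S" for u
  proof -
    have "\<exists>t. t \<in> H \<and> source t = u \<and> target t \<in> S"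
      using assms(1) that by (fastforce simp: perpetual_def)
    then show ?thesis unfolding f_def by (rule someI_ex)
  qed
  define p where "p i = ((\<lambda>t. f (target t)) ^^ i) (f v)" for i
  have Suc: "p (Suc i) = f (target (p i))" for i by (simp add: p_def)
  have p: "p i \<in> H \<and> source (p i) \<in> S \<and> target (p i) \<in> S" for i
    by (induction i) (use f assms(2) in \<open>auto simp: Suc p_def\<close>)
  show ?thesis
  proof (rule that)
    show "source (p 0) = v" using f assms(2) by (simp add: p_def)
    show "source (p (Suc i)) = target (p i)" for i using f p by (simp add: Suc)
  qed (use p in auto)
qed

lemma escapes_mono:
  assumes "escapes k H v w" "H \<subseteq> H'"
  shows "escapes k H' v w"
proof -
  have "surviving k H' S" if "surviving k H S" for S
    using that assms(2) unfolding surviving_def by (meson subsetD)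
  with assms(1) show ?thesis by (auto simp: escapes_def)
qed

text \<open>Adding a vertex other than \<open>v\<close> to a witnessing set keeps the set surviving
  when that vertex has a step into it.\<close>

lemma escapes_backwards:
  assumes "(w, u) \<in> (steps_avoiding H v)\<^sup>*" "escapes k H v u"
  shows "escapes k H v w"
  using assms
proof (induction rule: converse_rtrancl_induct)
  case (step p q)
  then obtain S where S: "q \<in> S" "v \<notin> S" "surviving k H S" by (auto simp: escapes_def)
  from step(1) obtain a where "p \<noteq> v" "(p, a, q) \<in> H"
    by (auto simp: steps_avoiding_def steps_def)
  with S have "surviving k H (insert p S)" "v \<notin> insert p S"
    unfolding surviving_def by auto
  then show ?case unfolding escapes_def by blast
qed

text \<open>A path to \<open>v\<close> can be cut at its first visit of \<open>v\<close>.\<close>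

lemma steps_avoiding_target:
  assumes "(w, v) \<in> (steps H)\<^sup>*"
  shows "(w, v) \<in> (steps_avoiding H v)\<^sup>*"
  using assms
proof (induction rule: converse_rtrancl_induct)
  case (step p q)
  then show ?case
    by (cases "p = v") (auto simp: steps_avoiding_def intro: converse_rtrancl_into_rtrancl)
qed simp

lemma steps_avoiding_subset: "steps_avoiding H v \<subseteq> steps H"
  by (auto simp: steps_avoiding_def)

lemma rtrancl_steps_avoiding: "(x, y) \<in> (steps_avoiding H v)\<^sup>* \<Longrightarrow> (x, y) \<in> (steps H)\<^sup>*"
  by (rule subsetD[OF rtrancl_mono[OF steps_avoiding_subset]])


section \<open>Entry subcharts\<close>

lemma path_snoc:
  "path C v (ts @ [t]) \<longleftrightarrow>
     path C v ts \<and> t \<in> transitions C \<and> source t = (if ts = [] then v else target (last ts))"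
  by (induction ts arbitrary: v) auto

lemma entry_path_singleton:
  "entry_path C L v \<alpha> [t] \<longleftrightarrow> t \<in> transitions C \<and> source t = v \<and> L t = \<alpha>"
  by (auto simp: entry_path_def)

lemma entry_path_snoc:
  assumes "ts \<noteq> []"
  shows "entry_path C L v \<alpha> (ts @ [t]) \<longleftrightarrow>
    entry_path C L v \<alpha> ts \<and> target (last ts) \<noteq> v \<and> t \<in> body C L \<and> source t = target (last ts)"
proof -
  have "set ts = insert (last ts) (set (butlast ts))"
    using assms by (metis append_butlast_last_id list.simps(15) rotate1.simps(2) set_rotate1)
  then show ?thesis
    using assms by (auto simp: entry_path_def path_snoc body_def)
qed

text \<open>The clause on the last target is the invariant that drives the induction: a path is only
  extended at a vertex other than \<open>v\<close>, which is then an interior vertex.\<close>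

lemma entry_path_interior:
  assumes "entry_path C L v \<alpha> ts"
  shows "(\<forall>t\<in>set ts. t \<in> transitions C \<and>
            (source t = v \<and> L t = \<alpha> \<or> source t \<in> interior C L v \<alpha> \<and> L t = 0)) \<and>
         target (last ts) \<in> insert v (interior C L v \<alpha>)"
  using assms
proof (induction ts rule: rev_induct)
  case Nil
  then show ?case by (simp add: entry_path_def)
next
  case (snoc t ts)
  obtain u a w where t: "t = (u, a, w)" by (cases t)
  show ?case
  proof (cases "ts = []")
    case True
    then show ?thesis using snoc.prems t by (auto simp: entry_path_singleton interior_def)
  next
    case False
    then have *: "entry_path C L v \<alpha> ts" "target (last ts) = u" "u \<noteq> v" "(u, a, w) \<in> body C L"
      using snoc.prems t by (auto simp: entry_path_snoc)
    then have u: "u \<in> interior C L v \<alpha>" using snoc.IH by auto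
    have "(u, w) \<in> steps_avoiding (body C L) v"
      using * by (auto simp: steps_avoiding_def steps_def)
    with u have "w \<in> insert v (interior C L v \<alpha>)"
      unfolding interior_def by (blast intro: rtrancl_into_rtrancl)
    with u * snoc.IH t show ?thesis by (auto simp: body_def)
  qed
qed

lemma interior_entry_path:
  assumes "u \<in> interior C L v \<alpha>"
  shows "\<exists>ts. entry_path C L v \<alpha> ts \<and> target (last ts) = u"
proof -
  from assms obtain a w where reach: "(w, u) \<in> (steps_avoiding (body C L) v)\<^sup>*"
    and entry: "(v, a, w) \<in> transitions C" "L (v, a, w) = \<alpha>"
    by (auto simp: interior_def)
  from reach show ?thesis
  proof (induction rule: rtrancl_induct)
    case base
    have "entry_path C L v \<alpha> [(v, a, w)]" using entry by (simp add: entry_path_singleton)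
    then show ?case by fastforce
  next
    case (step y z)
    then obtain ts b where ts: "entry_path C L v \<alpha> ts" "target (last ts) = y"
      and "y \<noteq> v" "(y, b, z) \<in> body C L"
      by (auto simp: steps_avoiding_def steps_def)
    moreover from ts have "ts \<noteq> []" by (auto simp: entry_path_def)
    ultimately have "entry_path C L v \<alpha> (ts @ [(y, b, z)])" by (simp add: entry_path_snoc)
    then show ?case by fastforce
  qed
qed

text \<open>Occurrence on some entry path reduces to a condition on the transition alone: an
  interior source is the end of an entry path, to which a body transition from there can be
  appended.\<close>

lemma transitions_entry_subchart:
  "t \<in> transitions (entry_subchart C L v \<alpha>) \<longleftrightarrow> t \<in> transitions C \<and>
     (source t = v \<and> L t = \<alpha> \<or> source t \<in> interior C L v \<alpha> \<and> L t = 0)"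
  (is "?l \<longleftrightarrow> ?r")
proof
  assume ?l
  then obtain ts where "entry_path C L v \<alpha> ts" "t \<in> set ts"
    by (auto simp: entry_subchart_def Let_def)
  with entry_path_interior[of C L v \<alpha> ts] show ?r by blast
next
  assume r: ?r
  have "\<exists>ts. entry_path C L v \<alpha> ts \<and> t \<in> set ts"
  proof (cases "source t = v \<and> L t = \<alpha>")
    case True
    then show ?thesis using r entry_path_singleton[of C L v \<alpha> t] by fastforce
  next
    case False
    with r have t: "source t \<in> interior C L v \<alpha>" "t \<in> body C L" by (auto simp: body_def)
    from interior_entry_path[OF t(1)] obtain ts
      where ts: "entry_path C L v \<alpha> ts" "target (last ts) = source t" by auto
    moreover from ts have "ts \<noteq> []" by (auto simp: entry_path_def)
    ultimately have "entry_path C L v \<alpha> (ts @ [t])"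
      using t by (auto simp: entry_path_snoc interior_def)
    then show ?thesis by fastforce
  qed
  then show ?l by (simp add: entry_subchart_def Let_def)
qed

lemma entry_subchart_simps [simp]:
  "start (entry_subchart C L v \<alpha>) = v" "tick (entry_subchart C L v \<alpha>) = tick C"
  "acts (entry_subchart C L v \<alpha>) = acts C"
  by (simp_all add: entry_subchart_def Let_def)

lemma verts_entry_subchart:
  "verts (entry_subchart C L v \<alpha>) =
     source ` transitions (entry_subchart C L v \<alpha>) \<union> target ` transitions (entry_subchart C L v \<alpha>)"
  by (simp add: entry_subchart_def Let_def)

lemma interior_step:
  assumes "u \<in> interior C L v \<alpha>" "(u, a, w) \<in> body C L" "w \<noteq> v"
  shows "w \<in> interior C L v \<alpha>"
proof -
  have "(u, w) \<in> steps_avoiding (body C L) v"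
    using assms by (auto simp: steps_avoiding_def steps_def interior_def)
  with assms show ?thesis unfolding interior_def by (blast intro: rtrancl_into_rtrancl)
qed

lemma interior_subset_verts: "interior C L v \<alpha> \<subseteq> verts (entry_subchart C L v \<alpha>)"
proof
  fix u assume "u \<in> interior C L v \<alpha>"
  from interior_entry_path[OF this] obtain ts
    where ts: "entry_path C L v \<alpha> ts" "target (last ts) = u" by auto
  then have "last ts \<in> set ts" by (auto simp: entry_path_def)
  with ts show "u \<in> verts (entry_subchart C L v \<alpha>)"
    by (auto simp: entry_subchart_def Let_def)
qed

lemma verts_subset_interior:
  "verts (entry_subchart C L v \<alpha>) \<subseteq> insert v (interior C L v \<alpha>)"
proof
  fix u assume "u \<in> verts (entry_subchart C L v \<alpha>)"
  then obtain t where t: "t \<in> transitions (entry_subchart C L v \<alpha>)" "u = source t \<or> u = target t"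
    by (auto simp: verts_entry_subchart)
  obtain x a y where xy: "t = (x, a, y)" by (cases t)
  from t(1) have "x = v \<and> (v, a, y) \<in> transitions C \<and> L (v, a, y) = \<alpha> \<or>
      x \<in> interior C L v \<alpha> \<and> (x, a, y) \<in> body C L"
    by (auto simp: transitions_entry_subchart xy body_def)
  then show "u \<in> insert v (interior C L v \<alpha>)"
  proof
    assume *: "x = v \<and> (v, a, y) \<in> transitions C \<and> L (v, a, y) = \<alpha>"
    then have "y \<in> insert v (interior C L v \<alpha>)" unfolding interior_def by blast
    with t xy * show ?thesis by auto
  next
    assume "x \<in> interior C L v \<alpha> \<and> (x, a, y) \<in> body C L"
    with interior_step[of x C L v \<alpha> a y] t xy show ?thesis by auto
  qed
qed


section \<open>LLEE-charts have no obstruction\<close>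

text \<open>(W1) excludes infinite body paths from the start vertex only. Reachability carries this
  to every vertex: behind a body transition the infinite path is extended backwards, and behind an
  entry transition it would never return to the source of the entry, against (L2).\<close>

lemma LLEE_witness_no_perpetual_body:
  assumes "chart C" "LLEE_witness C L" "perpetual (body C L) S"
  shows "S = {}"
proof -
  \<comment> \<open>\<open>S\<close> stays arbitrary in the induction, since the case of a body
    transition uses the hypothesis for \<open>insert u S\<close>.\<close>
  have "u \<notin> S" if "(start C, u) \<in> {(u, w). \<exists>a. (u, a, w) \<in> transitions C}\<^sup>*"
      "perpetual (body C L) S" for u S
    using that
  proof (induction arbitrary: S rule: rtrancl_induct)
    case base
    show ?case
    proof
      assume "start C \<in> S"
      from perpetual_inf_path[OF base this] obtain p where
        "source (p 0) = start C" "\<And>i. p i \<in> body C L" "\<And>i. source (p (Suc i)) = target (p i)"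
        by metis
      then have "inf_path C (start C) p \<and> (\<forall>i. L (p i) = 0)"
        by (auto simp: inf_path_def body_def)
      with assms(2) show False by (auto simp: LLEE_witness_def)
    qed
  next
    case (step u x)
    then obtain a where a: "(u, a, x) \<in> transitions C" by auto
    \<comment> \<open>The induction hypothesis for \<open>S\<close> itself: a body path inside
      \<open>S\<close> never visits \<open>u\<close>.\<close>
    have "u \<notin> S" using step by blast
    show ?case
    proof
      assume x: "x \<in> S"
      show False
      proof (cases "L (u, a, x) = 0")
        case True
        with step.prems a x have "perpetual (body C L) (insert u S)"
          unfolding perpetual_def body_def by blast
        with step.IH show False by blast
      next
        case False
        define \<alpha> where "\<alpha> = L (u, a, x)"
        have "u \<in> verts C" using a assms(1) by (auto simp: chart_def)
        moreover have "entry_departs C L u \<alpha>"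
          unfolding entry_departs_def \<alpha>_def using False a by force
        ultimately have loop: "loop_chart (entry_subchart C L u \<alpha>)"
          using assms(2) by (auto simp: LLEE_witness_def)
        from perpetual_inf_path[OF step.prems x] obtain p where
          p: "source (p 0) = x" "\<And>i. p i \<in> body C L" "\<And>i. source (p (Suc i)) = target (p i)"
            "\<And>i. source (p i) \<in> S" by metis
        have src: "source (p i) \<in> interior C L u \<alpha>" for i
        proof (induction i)
          case 0
          from p(1,4) \<open>u \<notin> S\<close> have "x \<noteq> u" by auto
          with a p(1) show ?case unfolding interior_def \<alpha>_def by blast
        next
          case (Suc i)
          obtain y b z where y: "p i = (y, b, z)" by (cases "p i")
          have "z \<noteq> u" using p(3)[of i] p(4)[of "Suc i"] \<open>u \<notin> S\<close> y by auto
          with interior_step[of y C L u \<alpha> b z] p(2)[of i] p(3)[of i] Suc y show ?case by auto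
        qed
        define q where "q i = (case i of 0 \<Rightarrow> (u, a, x) | Suc j \<Rightarrow> p j)" for i
        have tr: "q i \<in> transitions (entry_subchart C L u \<alpha>)" for i
          using a p(2) src
          by (cases i) (auto simp: q_def transitions_entry_subchart \<alpha>_def body_def)
        have "source (q (Suc i)) = target (q i)" for i
          using p(1,3) by (cases i) (auto simp: q_def)
        with tr have "inf_path (entry_subchart C L u \<alpha>) u q"
          by (auto simp: inf_path_def) (simp add: q_def)
        with loop obtain i where "target (q i) = u" by (auto simp: loop_chart_def)
        moreover have "target (q i) = source (p i)"
          using p(1,3) by (cases i) (auto simp: q_def)
        ultimately show False using p(4) \<open>u \<notin> S\<close> by metis
      qed
    qed
  qed
  moreover have "S \<subseteq> verts C"
    using assms(1,3) unfolding perpetual_def body_def chart_def by blast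
  ultimately show ?thesis using assms(1,3) unfolding chart_def by blast
qed

text \<open>Inside the loop of an entry of least positive level in \<open>H\<close>, an escaping run
  must keep to body transitions: termination is excluded by (L3), and entries by (W2)(b) together
  with minimality. It would thus be an infinite body path.\<close>

lemma LLEE_witness_no_obstruction:
  assumes "chart C" "LLEE_witness C L"
  shows "\<not> obstruction C H"
proof
  assume H: "obstruction C H"
  then have HC: "H \<subseteq> transitions C" by (simp add: obstruction_def)
  have "\<exists>t. t \<in> H \<and> L t \<noteq> 0"
  proof (rule ccontr)
    assume "\<not> ?thesis"
    with HC have "H \<subseteq> body C L" by (auto simp: body_def)
    with H obtain S where "S \<noteq> {}" "perpetual (body C L) S"
      unfolding obstruction_def perpetual_def by (metis subsetD)
    with LLEE_witness_no_perpetual_body[OF assms] show False by blast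
  qed
  then obtain t where t: "t \<in> H" "L t \<noteq> 0"
    and min: "\<And>t'. t' \<in> H \<Longrightarrow> L t' \<noteq> 0 \<Longrightarrow> L t \<le> L t'"
    using ex_has_least_nat[of "\<lambda>t. t \<in> H \<and> L t \<noteq> 0" _ L] by metis
  obtain v a w where vw: "t = (v, a, w)" by (cases t)
  define \<alpha> where "\<alpha> = L t"
  have tC: "(v, a, w) \<in> transitions C" using t HC vw by auto
  have "v \<in> verts C" using tC assms(1) by (auto simp: chart_def)
  moreover have "entry_departs C L v \<alpha>"
    unfolding entry_departs_def \<alpha>_def using t tC vw by force
  ultimately have loop: "loop_chart (entry_subchart C L v \<alpha>)"
    and low: "\<And>u \<beta>. u \<in> verts (entry_subchart C L v \<alpha>) - {v} \<Longrightarrow> \<beta> \<ge> \<alpha> \<Longrightarrow> \<not> entry_departs C L u \<beta>"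
    using assms(2) unfolding LLEE_witness_def by blast+
  have "escapes (tick C) H v w" using H t vw by (simp add: obstruction_def)
  then obtain S where S: "w \<in> S" "v \<notin> S" "surviving (tick C) H S"
    by (auto simp: escapes_def)
  \<comment> \<open>The part of the escape inside the loop. Since \<open>S\<close> avoids
    \<open>v\<close>, body transitions from \<open>S'\<close> into \<open>S\<close> end in the
    interior again.\<close>
  define S' where "S' = S \<inter> interior C L v \<alpha>"
  have "perpetual (body C L) S'"
    unfolding perpetual_def
  proof
    fix u assume u: "u \<in> S'"
    then have uv: "u \<in> verts (entry_subchart C L v \<alpha>)" "u \<noteq> v"
      using interior_subset_verts[of C L v \<alpha>] by (auto simp: S'_def interior_def)
    with loop have "u \<noteq> tick C" by (auto simp: loop_chart_def)
    with u S(3) obtain b x where x: "(u, b, x) \<in> H" "x \<in> S"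
      by (auto simp: surviving_def S'_def)
    have "L (u, b, x) = 0"
    proof (rule ccontr)
      assume nz: "L (u, b, x) \<noteq> 0"
      with min x have "L (u, b, x) \<ge> \<alpha>" by (simp add: \<alpha>_def)
      moreover have "entry_departs C L u (L (u, b, x))"
        unfolding entry_departs_def using nz x HC by force
      ultimately show False using low uv by blast
    qed
    then have "(u, b, x) \<in> body C L" using x HC by (auto simp: body_def)
    moreover have "x \<noteq> v" using x S by auto
    ultimately show "\<exists>b x. (u, b, x) \<in> body C L \<and> x \<in> S'"
      using interior_step u x unfolding S'_def by fastforce
  qed
  moreover have "w \<in> S'"
    using S tC vw unfolding S'_def \<alpha>_def interior_def by blast
  ultimately show False using LLEE_witness_no_perpetual_body[OF assms] by blast
qed


section \<open>Charts without obstruction are LLEE-charts\<close>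

text \<open>Condition (W2), with the loop property expressed through escapes.\<close>

definition layered :: "('v, 'a) pre_chart \<Rightarrow> ('v, 'a) labeling \<Rightarrow> bool" where
  "layered C L \<longleftrightarrow> (\<forall>v a w. (v, a, w) \<in> transitions C \<longrightarrow> L (v, a, w) \<noteq> 0 \<longrightarrow>
     \<not> escapes (tick C) (body C L) v w \<and> (w, v) \<in> (steps (body C L))\<^sup>* \<and>
     (\<forall>u \<in> interior C L v (L (v, a, w)). \<forall>t \<in> transitions C. source t = u \<longrightarrow> L t < L (v, a, w)))"

text \<open>Such a transition can serve as the entry of a loop with body in \<open>B\<close>: the
  return path gives (L1), and the absence of an escape gives (L2) and (L3).\<close>

definition removable :: "('v, 'a) pre_chart \<Rightarrow> ('v, 'a) transition set \<Rightarrow> ('v, 'a) transition \<Rightarrow> bool" where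
  "removable C B t \<longleftrightarrow> t \<in> B \<and> (target t, source t) \<in> (steps B)\<^sup>* \<and>
     \<not> escapes (tick C) B (source t) (target t)"

text \<open>If every transition of \<open>B\<close> whose target leads back to its source escapes,
  then so does every transition of \<open>B\<close> whose target lies in a surviving set, and the
  latter transitions form an obstruction.\<close>

lemma removable_exists:
  assumes "\<And>H. \<not> obstruction C H" "B \<subseteq> transitions C" "perpetual B S" "S \<noteq> {}"
  shows "\<exists>t. removable C B t"
proof (rule ccontr)
  assume none: "\<not> ?thesis"
  text \<open>Pruning transitions into dead ends leaves an obstruction.\<close>
  define H where "H = {(v, a, w). (v, a, w) \<in> B \<and> (\<exists>S. w \<in> S \<and> surviving (tick C) B S)}"
  have H: "surviving (tick C) H S" if "surviving (tick C) B S" for S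
    using that unfolding surviving_def H_def by blast
  have "escapes (tick C) H v w" if vw: "(v, a, w) \<in> H" for v a w
  proof -
    from vw obtain S where S: "(v, a, w) \<in> B" "w \<in> S" "surviving (tick C) B S"
      by (auto simp: H_def)
    have "\<exists>S. w \<in> S \<and> v \<notin> S \<and> surviving (tick C) B S"
    proof (cases "(w, v) \<in> (steps B)\<^sup>*")
      case True
      with none S show ?thesis by (auto simp: removable_def escapes_def)
    next
      case False
      \<comment> \<open>Without a return to \<open>v\<close>, the vertices of \<open>S\<close>
        reachable from \<open>w\<close> already avoid \<open>v\<close>.\<close>
      let ?S = "{y \<in> S. (w, y) \<in> (steps B)\<^sup>*}"
      have "surviving (tick C) B ?S"
        unfolding surviving_def
      proof
        fix u assume u: "u \<in> ?S"
        with S consider "u = tick C" | b x where "(u, b, x) \<in> B" "x \<in> S"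
          by (auto simp: surviving_def)
        then show "u = tick C \<or> (\<exists>b x. (u, b, x) \<in> B \<and> x \<in> ?S)"
        proof cases
          case 2
          then have "(u, x) \<in> steps B" by (auto simp: steps_def)
          with u 2 show ?thesis by (blast intro: rtrancl_into_rtrancl)
        qed simp
      qed
      with False S show ?thesis by (intro exI[of _ ?S]) auto
    qed
    with H show ?thesis unfolding escapes_def by blast
  qed
  moreover have "perpetual H S"
  proof -
    have "surviving (tick C) B S"
      using assms(3) by (auto simp: surviving_def perpetual_def)
    with assms(3) show ?thesis unfolding perpetual_def H_def by blast
  qed
  moreover have "H \<subseteq> transitions C" using assms(2) by (auto simp: H_def)
  ultimately show False using assms(1,4) unfolding obstruction_def by blast
qed

text \<open>A cycle through \<open>u\<close> must pass \<open>v\<close>, and then the loops at \<open>v\<close> and at \<open>u\<close> guard each other.\<close>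

lemma removable_outwards:
  assumes t: "removable C B (u, a, x)" and u: "u \<noteq> v" "\<not> escapes (tick C) B v u"
  shows "\<exists>b z. removable C B (v, b, z)"
proof -
  from t have uB: "(u, a, x) \<in> B" and xu: "(x, u) \<in> (steps_avoiding B u)\<^sup>*"
    and ne: "\<not> escapes (tick C) B u x"
    by (auto simp: removable_def intro: steps_avoiding_target)
  \<comment> \<open>\<open>Y\<close> consists of the vertices on the paths from \<open>x\<close>
    that halt at \<open>u\<close>; the transition from \<open>u\<close> to \<open>x\<close> closes
    them to cycles.\<close>
  define Y where "Y = {y. (x, y) \<in> (steps_avoiding B u)\<^sup>* \<and> (y, u) \<in> (steps_avoiding B u)\<^sup>*}"
  have Y: "\<exists>b z. (y, b, z) \<in> B \<and> z \<in> Y" if y: "y \<in> Y" for y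
  proof (cases "y = u")
    case True
    then show ?thesis using uB xu by (auto simp: Y_def)
  next
    case False
    with y obtain z where z: "(y, z) \<in> steps_avoiding B u" "(z, u) \<in> (steps_avoiding B u)\<^sup>*"
      by (auto simp: Y_def elim: converse_rtranclE)
    with y have "z \<in> Y" by (auto simp: Y_def intro: rtrancl_into_rtrancl)
    with z show ?thesis by (auto simp: steps_avoiding_def steps_def)
  qed
  \<comment> \<open>Otherwise \<open>Y\<close> would be a surviving set that contains
    \<open>u\<close> and misses \<open>v\<close>.\<close>
  have "v \<in> Y"
  proof (rule ccontr)
    assume "v \<notin> Y"
    moreover have "u \<in> Y" using xu by (auto simp: Y_def)
    moreover have "surviving (tick C) B Y" using Y by (auto simp: surviving_def)
    ultimately show False using u(2) unfolding escapes_def by blast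
  qed
  with Y obtain b z where z: "(v, b, z) \<in> B" "z \<in> Y" by blast
  have "(z, v) \<in> (steps B)\<^sup>*"
  proof -
    have "(z, u) \<in> (steps B)\<^sup>*" "(x, v) \<in> (steps B)\<^sup>*"
      using z \<open>v \<in> Y\<close> by (auto simp: Y_def intro: rtrancl_steps_avoiding)
    moreover have "(u, x) \<in> steps B" using uB by (auto simp: steps_def)
    ultimately show ?thesis by (meson rtrancl.rtrancl_into_rtrancl rtrancl_trans)
  qed
  \<comment> \<open>An escape from \<open>z\<close> that misses \<open>v\<close> must also miss
    \<open>u\<close>, as \<open>u\<close> has no escape avoiding \<open>v\<close>. Pulled back along
    the path from \<open>x\<close> to \<open>z\<close>, it would give \<open>x\<close> an escape
    avoiding \<open>u\<close>.\<close>
  moreover have "\<not> escapes (tick C) B v z"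
  proof
    assume "escapes (tick C) B v z"
    then obtain S where S: "z \<in> S" "v \<notin> S" "surviving (tick C) B S" by (auto simp: escapes_def)
    with u(2) have "u \<notin> S" unfolding escapes_def by blast
    with S have "escapes (tick C) B u z" unfolding escapes_def by blast
    with z ne show False by (auto simp: Y_def dest: escapes_backwards)
  qed
  ultimately show ?thesis using z by (auto simp: removable_def)
qed

text \<open>An escape from an interior vertex could be pulled back along a body path to the target
  of an entry, which layering forbids.\<close>

lemma interior_not_escapes:
  assumes "layered C L" "u \<in> interior C L v \<alpha>" "\<alpha> \<noteq> 0"
  shows "\<not> escapes (tick C) (body C L) v u"
  using assms unfolding layered_def interior_def by (blast dest: escapes_backwards)

text \<open>By layering, moving outwards to the entry of a surrounding loop strictly increases its level.\<close>

lemma removable_outside_interiors: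
  assumes "finite (transitions C)" "layered C L" "removable C (body C L) t"
  obtains t' where "removable C (body C L) t'"
    "\<And>v \<alpha>. \<alpha> \<noteq> 0 \<Longrightarrow> source t' \<notin> interior C L v \<alpha>"
proof (rule ccontr)
  assume "\<not> thesis"
  with that have all: "\<exists>v \<alpha>. \<alpha> \<noteq> 0 \<and> source t' \<in> interior C L v \<alpha>"
    if "removable C (body C L) t'" for t' using that by blast
  \<comment> \<open>\<open>N\<close> collects the levels of the loops whose interior contains the
    source of a removable transition; its maximum leads to the contradiction.\<close>
  define N where "N = {\<alpha>. \<alpha> \<noteq> 0 \<and>
    (\<exists>v t. removable C (body C L) t \<and> source t \<in> interior C L v \<alpha>)}"
  have "N \<subseteq> L ` transitions C" by (auto simp: N_def interior_def)
  then have fin: "finite N" using assms(1) by (blast intro: finite_subset)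
  moreover have "N \<noteq> {}" using all[OF assms(3)] assms(3) unfolding N_def by blast
  ultimately have "Max N \<in> N" by (rule Max_in)
  then obtain v t where t: "Max N \<noteq> 0" "removable C (body C L) t" "source t \<in> interior C L v (Max N)"
    by (auto simp: N_def)
  obtain u a x where ux: "t = (u, a, x)" by (cases t)
  have "u \<noteq> v" using t ux by (simp add: interior_def)
  with t ux obtain b z where vz: "removable C (body C L) (v, b, z)"
    using removable_outwards interior_not_escapes[OF assms(2)] by (metis fst_conv)
  from all[OF this] obtain v' \<beta> where \<beta>: "\<beta> \<noteq> 0" "v \<in> interior C L v' \<beta>" by auto
  then have "\<beta> \<in> N" using vz by (force simp: N_def)
  \<comment> \<open>The interior is nonempty, so an entry of level \<open>Max N\<close> departs from
    \<open>v\<close>. As \<open>v\<close> lies inside a loop of level \<open>\<beta>\<close>,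
    layering puts \<open>\<beta>\<close> above that maximum.\<close>
  from t(3) obtain s where s: "s \<in> transitions C" "source s = v" "L s = Max N"
    by (auto simp: interior_def)
  from \<beta> obtain a' w' where "(v', a', w') \<in> transitions C" "L (v', a', w') = \<beta>"
    by (auto simp: interior_def)
  with assms(2) \<beta> s have "Max N < \<beta>" unfolding layered_def by metis
  with Max_ge[OF fin \<open>\<beta> \<in> N\<close>] show False by simp
qed

text \<open>The source of \<open>t\<close> lies in no loop interior, so the body paths of existing
  loops never use \<open>t\<close> and still return. The same holds for the new loop, whose paths
  halt at that source. The level \<open>n\<close> exceeds every old label, hence all labels inside
  the new loop.\<close>

lemma layered_extend:
  assumes "layered C L" "removable C (body C L) t"
    and out: "\<And>v \<alpha>. \<alpha> \<noteq> 0 \<Longrightarrow> source t \<notin> interior C L v \<alpha>"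
    and n: "\<And>t'. t' \<in> transitions C \<Longrightarrow> L t' < n"
  shows "layered C (L(t := n))"
proof -
  let ?L = "L(t := n)"
  obtain u a x where ux: "t = (u, a, x)" by (cases t)
  have tB: "t \<in> body C L" using assms(2) by (simp add: removable_def)
  have "n \<noteq> 0" using n tB by (fastforce simp: body_def)
  then have body: "body C ?L = body C L - {t}" by (auto simp: body_def)
  have av: "steps_avoiding (body C ?L) v \<subseteq> steps_avoiding (body C L) v" for v
    by (auto simp: body steps_avoiding_def steps_def)
  show ?thesis unfolding layered_def
  proof (intro allI impI conjI ballI)
    fix v b w assume vw: "(v, b, w) \<in> transitions C" "?L (v, b, w) \<noteq> 0"
    have old: "\<not> escapes (tick C) (body C L) v w \<and> (w, v) \<in> (steps (body C L))\<^sup>*"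
      using assms(1,2) vw by (cases "(v, b, w) = t") (auto simp: layered_def removable_def)
    then show "\<not> escapes (tick C) (body C ?L) v w"
      using body by (blast dest: escapes_mono)
    have not_t: "p \<noteq> u \<or> v = u" if "(w, p) \<in> (steps_avoiding (body C L) v)\<^sup>*" "p \<noteq> v" for p
    proof (cases "(v, b, w) = t")
      case False
      then have "L (v, b, w) \<noteq> 0" using vw by auto
      from out[OF this, of v] that vw show ?thesis by (auto simp: interior_def ux)
    qed (simp add: ux)
    have reach: "(w, y) \<in> (steps_avoiding (body C ?L) v)\<^sup>*"
      if "(w, y) \<in> (steps_avoiding (body C L) v)\<^sup>*" for y
      using that
    proof (induction rule: rtrancl_induct)
      case (step y z)
      then have "(y, z) \<in> steps_avoiding (body C ?L) v"
        using not_t[of y] ux unfolding body by (auto simp: steps_avoiding_def steps_def)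
      with step.IH show ?case by (rule rtrancl_into_rtrancl)
    qed simp
    then show "(w, v) \<in> (steps (body C ?L))\<^sup>*"
      using old by (blast intro: rtrancl_steps_avoiding dest: steps_avoiding_target)
    fix y s assume y: "y \<in> interior C ?L v (?L (v, b, w))" and s: "s \<in> transitions C" "source s = y"
    have yv: "y \<noteq> v" using y by (simp add: interior_def)
    show "?L s < ?L (v, b, w)"
    proof (cases "(v, b, w) = t")
      case True
      with yv s ux n show ?thesis by auto
    next
      case False
      then have L: "?L (v, b, w) = L (v, b, w)" by auto
      \<comment> \<open>\<open>t\<close> now has level \<open>n\<close>, so it is not among the
        entries that span this interior.\<close>
      have "L (v, b, w) < n" using n vw by blast
      then have "y \<in> interior C L v (L (v, b, w))"
        using y rtrancl_mono[OF av[of v]] unfolding L interior_def by (auto split: if_splits)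
      moreover have "L (v, b, w) \<noteq> 0" using vw L by simp
      moreover have "s \<noteq> t" using calculation s out by blast
      ultimately show ?thesis using assms(1) vw s L unfolding layered_def by auto
    qed
  qed
qed

section \<open>From layered labelings to LLEE-witnesses\<close>

lemma layered_loop_chart:
  assumes C: "chart C" and lay: "layered C L" and "entry_departs C L v \<alpha>"
  shows "loop_chart (entry_subchart C L v \<alpha>)"
proof -
  let ?E = "entry_subchart C L v \<alpha>"
  let ?T = "transitions ?E"
  from assms(3) obtain a w where vw: "(v, a, w) \<in> transitions C" "L (v, a, w) = \<alpha>" and \<alpha>: "\<alpha> \<noteq> 0"
    by (fastforce simp: entry_departs_def)
  have vwT: "(v, a, w) \<in> ?T" using vw by (simp add: transitions_entry_subchart)
  have TC: "?T \<subseteq> transitions C" by (auto simp: transitions_entry_subchart)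
  have vtick: "v \<noteq> tick C" using vw C by (fastforce simp: chart_def)
  have vE: "v \<in> verts ?E" using vwT by (force simp: verts_entry_subchart)
  have TE: "?T \<subseteq> verts ?E \<times> acts C \<times> verts ?E"
  proof
    fix t assume t: "t \<in> ?T"
    then have "source t \<in> verts ?E" "target t \<in> verts ?E"
      by (simp_all add: verts_entry_subchart)
    moreover have "t \<in> verts C \<times> acts C \<times> verts C"
      using t TC C unfolding chart_def by blast
    ultimately show "t \<in> verts ?E \<times> acts C \<times> verts ?E" by auto
  qed
  have fin: "finite ?T" using C TC by (auto simp: chart_def intro: finite_subset)
  have reach: "(v, u) \<in> (steps ?T)\<^sup>*" if "u \<in> verts ?E" for u
  proof (cases "u = v")
    case False
    then have u: "u \<in> interior C L v \<alpha>" using that verts_subset_interior by fastforce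
    then obtain b x where x: "(v, b, x) \<in> transitions C" "L (v, b, x) = \<alpha>"
      "(x, u) \<in> (steps_avoiding (body C L) v)\<^sup>*" by (auto simp: interior_def)
    from x(3) show ?thesis
    proof (induction rule: rtrancl_induct)
      case base
      have "(v, b, x) \<in> ?T" using x by (simp add: transitions_entry_subchart)
      then show ?case by (auto simp: steps_def)
    next
      case (step y z)
      then obtain c where c: "y \<noteq> v" "(y, c, z) \<in> body C L"
        by (auto simp: steps_avoiding_def steps_def)
      with step x have "y \<in> interior C L v \<alpha>" unfolding interior_def by blast
      with c have "(y, c, z) \<in> ?T" by (auto simp: transitions_entry_subchart body_def)
      then have "(y, z) \<in> steps ?T" by (auto simp: steps_def)
      with step.IH show ?case by (rule rtrancl_into_rtrancl)
    qed
  qed simp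
  have "chart ?E"
    unfolding chart_def
  proof (intro conjI)
    show "finite (verts ?E)" using fin by (simp add: verts_entry_subchart)
    show "\<forall>t\<in>?T. source t \<noteq> tick ?E" using C TC by (auto simp: chart_def)
    show "\<forall>u\<in>verts ?E. (start ?E, u) \<in> {(u, w). \<exists>a. (u, a, w) \<in> ?T}\<^sup>*"
      using reach by (simp add: steps_def)
  qed (use vE vtick TE fin in auto)
  moreover have "\<exists>p. inf_path ?E v p"
  proof -
    have wv: "(w, v) \<in> (steps_avoiding (body C L) v)\<^sup>*"
      using lay vw \<alpha> by (auto simp: layered_def intro: steps_avoiding_target)
    \<comment> \<open>\<open>S\<close> traces the cycles formed by the entry transition and the
      return paths from \<open>w\<close> to \<open>v\<close>, so each of its vertices has a
      successor in it.\<close>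
    define S where "S = {y. (w, y) \<in> (steps_avoiding (body C L) v)\<^sup>* \<and>
      (y, v) \<in> (steps_avoiding (body C L) v)\<^sup>*}"
    have "perpetual ?T S"
      unfolding perpetual_def
    proof
      fix y assume y: "y \<in> S"
      show "\<exists>b z. (y, b, z) \<in> ?T \<and> z \<in> S"
      proof (cases "y = v")
        case True
        then show ?thesis using vwT wv by (auto simp: S_def)
      next
        case False
        with y obtain z where z: "(y, z) \<in> steps_avoiding (body C L) v"
          "(z, v) \<in> (steps_avoiding (body C L) v)\<^sup>*"
          by (auto simp: S_def elim: converse_rtranclE)
        with y have "z \<in> S" by (auto simp: S_def intro: rtrancl_into_rtrancl)
        moreover have "y \<in> interior C L v \<alpha>"
          using y False vw unfolding S_def interior_def by blast
        moreover obtain b where "(y, b, z) \<in> body C L"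
          using z by (auto simp: steps_avoiding_def steps_def)
        ultimately show ?thesis by (force simp: transitions_entry_subchart body_def)
      qed
    qed
    moreover have "v \<in> S" using wv by (simp add: S_def)
    ultimately obtain p where "source (p 0) = v" "\<And>i. p i \<in> ?T"
      "\<And>i. source (p (Suc i)) = target (p i)"
      using perpetual_inf_path by metis
    then have "inf_path ?E v p" by (simp add: inf_path_def)
    then show ?thesis by blast
  qed
  moreover have "\<exists>i. target (p i) = v" if p: "inf_path ?E v p" for p
  proof (rule ccontr)
    assume no: "\<not> ?thesis"
    have p0: "source (p 0) = v" and pT: "\<And>i. p i \<in> ?T"
      and pS: "\<And>i. source (p (Suc i)) = target (p i)"
      using p by (auto simp: inf_path_def)
    obtain b x where x: "p 0 = (v, b, x)" using p0 by (cases "p 0") auto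
    have xT: "(v, b, x) \<in> transitions C" "L (v, b, x) = \<alpha>"
      using pT[of 0] x by (auto simp: transitions_entry_subchart interior_def)
    \<comment> \<open>After its first transition, a path that never returns uses body transitions
      only, so its vertices form an escape avoiding \<open>v\<close>.\<close>
    define S where "S = range (\<lambda>i. source (p (Suc i)))"
    have "v \<notin> S" using no pS by (auto simp: S_def)
    have "surviving (tick C) (body C L) S"
      unfolding surviving_def
    proof
      fix y assume y: "y \<in> S"
      then obtain i where i: "y = source (p (Suc i))" by (auto simp: S_def)
      obtain c z where z: "p (Suc i) = (y, c, z)" using i by (cases "p (Suc i)") auto
      have "(y, c, z) \<in> body C L"
        using pT[of "Suc i"] z y \<open>v \<notin> S\<close> by (auto simp: transitions_entry_subchart body_def)
      moreover have "z \<in> S" using pS[of "Suc i"] z by (force simp: S_def)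
      ultimately show "y = tick C \<or> (\<exists>c z. (y, c, z) \<in> body C L \<and> z \<in> S)" by blast
    qed
    moreover have "x \<in> S" using pS[of 0] x by (force simp: S_def)
    ultimately have "escapes (tick C) (body C L) v x"
      using \<open>v \<notin> S\<close> unfolding escapes_def by blast
    with lay xT \<alpha> show False by (auto simp: layered_def)
  qed
  moreover have "tick C \<notin> verts ?E"
  proof
    assume "tick C \<in> verts ?E"
    with vtick have "tick C \<in> interior C L v \<alpha>" using verts_subset_interior by fastforce
    \<comment> \<open>The termination vertex alone forms a surviving set, so inside the loop it
      would escape.\<close>
    from interior_not_escapes[OF lay this \<alpha>] show False
      using vtick unfolding escapes_def surviving_def by blast
  qed
  ultimately show ?thesis by (simp add: loop_chart_def)
qed

text \<open>An infinite body path would make its set of sources perpetual. For (W2)(b), an interior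
  vertex presupposes an entry of level \<open>\<alpha>\<close> at \<open>v\<close>, and layering for
  this entry bounds all labels there.\<close>

lemma layered_LLEE_witness:
  assumes C: "chart C" and lay: "layered C L" and "\<And>S. perpetual (body C L) S \<Longrightarrow> S = {}"
  shows "LLEE_witness C L"
  unfolding LLEE_witness_def
proof (intro conjI ballI allI impI notI)
  assume "\<exists>p. inf_path C (start C) p \<and> (\<forall>i. L (p i) = 0)"
  then obtain p where p: "inf_path C (start C) p" "\<And>i. L (p i) = 0" by blast
  have "perpetual (body C L) (range (\<lambda>i. source (p i)))"
    unfolding perpetual_def
  proof
    fix u assume "u \<in> range (\<lambda>i. source (p i))"
    then obtain i where "u = source (p i)" by auto
    moreover have "p i = (source (p i), fst (snd (p i)), source (p (Suc i)))" "p i \<in> body C L"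
      using p by (auto simp: inf_path_def body_def)
    ultimately show "\<exists>a w. (u, a, w) \<in> body C L \<and> w \<in> range (\<lambda>i. source (p i))"
      by (metis rangeI)
  qed
  with assms(3) show False by blast
next
  fix v \<alpha> assume v: "entry_departs C L v \<alpha>"
  then show "loop_chart (entry_subchart C L v \<alpha>)" by (rule layered_loop_chart[OF C lay])
  fix w assume w: "w \<in> verts (entry_subchart C L v \<alpha>) - {v}" and "\<exists>\<beta>\<ge>\<alpha>. entry_departs C L w \<beta>"
  then obtain t where t: "t \<in> transitions C" "source t = w" "L t \<ge> \<alpha>"
    by (auto simp: entry_departs_def)
  have wi: "w \<in> interior C L v \<alpha>" using w verts_subset_interior by fastforce
  moreover have "\<alpha> \<noteq> 0" using v by (simp add: entry_departs_def)
  ultimately have "L t < \<alpha>"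
    using lay t unfolding layered_def interior_def by blast
  with t show False by simp
qed

text \<open>A layered labeling with the fewest body transitions stands for the end of the greedy
  elimination: a nonempty perpetual set of its body would yield a removable transition outside all
  interiors, and promoting it to a new top level would leave fewer.\<close>

lemma no_obstruction_LLEE_chart:
  assumes C: "chart C" and no: "\<And>H. \<not> obstruction C H"
  shows "LLEE_chart C"
proof -
  have fin: "finite (transitions C)" using C by (simp add: chart_def)
  have "layered C (\<lambda>_. 0)" by (simp add: layered_def)
  from ex_has_least_nat[of "layered C", OF this, of "\<lambda>L. card (body C L)"]
  obtain L where L: "layered C L"
    and min: "\<And>L'. layered C L' \<Longrightarrow> card (body C L) \<le> card (body C L')" by blast
  have "S = {}" if S: "perpetual (body C L) S" for S
  proof (rule ccontr)
    assume "S \<noteq> {}"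
    with removable_exists[OF no _ S] obtain t0 where "removable C (body C L) t0"
      by (auto simp: body_def)
    then obtain t where t: "removable C (body C L) t"
      "\<And>v \<alpha>. \<alpha> \<noteq> 0 \<Longrightarrow> source t \<notin> interior C L v \<alpha>"
      using removable_outside_interiors[OF fin L] by blast
    define n where "n = Suc (Max (L ` transitions C))"
    have n: "L t' < n" if "t' \<in> transitions C" for t'
      using that fin by (simp add: n_def less_Suc_eq_le)
    have tB: "t \<in> body C L" using t by (simp add: removable_def)
    then have "body C (L(t := n)) \<subset> body C L" by (auto simp: body_def n_def)
    then have "card (body C (L(t := n))) < card (body C L)"
      using fin by (intro psubset_card_mono) (auto simp: body_def)
    moreover have "layered C (L(t := n))" by (rule layered_extend[OF L t n])
    ultimately show False using min by fastforce
  qed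
  with C L show ?thesis using layered_LLEE_witness unfolding LLEE_chart_def by blast
qed


section \<open>The collapse\<close>

lemma bisimilarity_step:
  assumes "(v, w) \<in> bisimilarity C"
  shows "v \<in> verts C" "w \<in> verts C" "v = tick C \<longleftrightarrow> w = tick C"
    "(v, a, v') \<in> transitions C \<Longrightarrow> \<exists>w'. (w, a, w') \<in> transitions C \<and> (v', w') \<in> bisimilarity C"
proof -
  from assms obtain R where R: "bisimulation C R" "(v, w) \<in> R" by (auto simp: bisimilarity_def)
  then show "v \<in> verts C" "w \<in> verts C" "v = tick C \<longleftrightarrow> w = tick C"
    unfolding bisimulation_def by auto
  assume "(v, a, v') \<in> transitions C"
  with R obtain w' where "(w, a, w') \<in> transitions C" "(v', w') \<in> R"
    unfolding bisimulation_def by fast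
  with R show "\<exists>w'. (w, a, w') \<in> transitions C \<and> (v', w') \<in> bisimilarity C"
    by (auto simp: bisimilarity_def)
qed

lemma bisimulation_converse: "bisimulation C R \<Longrightarrow> bisimulation C (R\<inverse>)"
  unfolding bisimulation_def by fast

lemma bisimulation_relcomp:
  assumes "bisimulation C R" "bisimulation C S"
  shows "bisimulation C (R O S)"
proof -
  have "(\<forall>a v'. (v, a, v') \<in> transitions C \<longrightarrow>
            (\<exists>w'. (w, a, w') \<in> transitions C \<and> (v', w') \<in> R O S)) \<and>
        (\<forall>a w'. (w, a, w') \<in> transitions C \<longrightarrow>
            (\<exists>v'. (v, a, v') \<in> transitions C \<and> (v', w') \<in> R O S)) \<and>
        (v = tick C \<longleftrightarrow> w = tick C)" if vw: "(v, w) \<in> R O S" for v w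
  proof -
    from vw obtain u where u: "(v, u) \<in> R" "(u, w) \<in> S" by auto
    have R: "\<forall>a v'. (v, a, v') \<in> transitions C \<longrightarrow> (\<exists>u'. (u, a, u') \<in> transitions C \<and> (v', u') \<in> R)"
        "\<forall>a u'. (u, a, u') \<in> transitions C \<longrightarrow> (\<exists>v'. (v, a, v') \<in> transitions C \<and> (v', u') \<in> R)"
        "v = tick C \<longleftrightarrow> u = tick C"
      using assms(1) u(1) unfolding bisimulation_def by auto
    have S: "\<forall>a u'. (u, a, u') \<in> transitions C \<longrightarrow> (\<exists>w'. (w, a, w') \<in> transitions C \<and> (u', w') \<in> S)"
        "\<forall>a w'. (w, a, w') \<in> transitions C \<longrightarrow> (\<exists>u'. (u, a, u') \<in> transitions C \<and> (u', w') \<in> S)"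
        "u = tick C \<longleftrightarrow> w = tick C"
      using assms(2) u(2) unfolding bisimulation_def by auto
    from R S show ?thesis by (meson relcompI)
  qed
  moreover have "R O S \<subseteq> verts C \<times> verts C" using assms by (auto simp: bisimulation_def)
  ultimately show ?thesis unfolding bisimulation_def by blast
qed

lemma equiv_bisimilarity:
  assumes "chart C"
  shows "equiv (verts C) (bisimilarity C)"
proof (rule equivI)
  show "bisimilarity C \<subseteq> verts C \<times> verts C"
    by (auto simp: bisimilarity_def bisimulation_def)
  have "bisimulation C (Id_on (verts C))"
    using assms by (auto simp: bisimulation_def chart_def)
  then show "refl_on (verts C) (bisimilarity C)"
    unfolding bisimilarity_def by (auto intro!: refl_onI)
  show "sym (bisimilarity C)"
    using bisimulation_converse by (fastforce intro!: symI simp: bisimilarity_def)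
  show "trans (bisimilarity C)"
    using bisimulation_relcomp by (fastforce intro!: transI simp: bisimilarity_def)
qed

text \<open>The class of \<open>u\<close> contains \<open>u\<close>, so equality relates
  \<open>tick C\<close> to \<open>u\<close>. This also covers the case in which
  \<open>tick C\<close> is not a vertex and its image is empty.\<close>

lemma collapse_tick_class:
  assumes "chart C" "u \<in> verts C" "bisimilarity C `` {u} = bisimilarity C `` {tick C}"
  shows "u = tick C"
proof -
  have "(u, u) \<in> bisimilarity C"
    using equiv_bisimilarity[OF assms(1)] assms(2) by (auto simp: equiv_def refl_on_def)
  with assms(3) have "(tick C, u) \<in> bisimilarity C" by auto
  then show ?thesis using bisimilarity_step(3) by fastforce
qed

lemma collapse_transition:
  assumes "chart C" "(v, a, w) \<in> transitions C"
  shows "(bisimilarity C `` {v}, a, bisimilarity C `` {w}) \<in> transitions (bisim_collapse C)"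
proof -
  have "v \<in> verts C" "w \<in> verts C" using assms by (auto simp: chart_def)
  then show ?thesis
    using assms(2) equiv_class_self[OF equiv_bisimilarity[OF assms(1)]]
    by (fastforce simp: bisim_collapse_def intro: quotientI)
qed

lemma chart_bisim_collapse:
  assumes C: "chart C"
  shows "chart (bisim_collapse C)"
proof -
  let ?D = "bisim_collapse C"
  let ?q = "\<lambda>v. bisimilarity C `` {v}"
  have C': "finite (verts C)" "start C \<in> verts C" "start C \<noteq> tick C" "finite (transitions C)"
    "transitions C \<subseteq> verts C \<times> acts C \<times> verts C"
    using C by (auto simp: chart_def)
  have fin: "finite (verts ?D)"
    using C'(1) by (simp add: bisim_collapse_def quotient_def)
  \<comment> \<open>The action set may be infinite, so finiteness comes from the actions that occur
    on transitions of \<open>C\<close>.\<close>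
  have T: "transitions ?D \<subseteq> verts ?D \<times> ((\<lambda>t. fst (snd t)) ` transitions C) \<times> verts ?D"
    by (force simp: bisim_collapse_def)
  show ?thesis
    unfolding chart_def
  proof (intro conjI ballI)
    show "start ?D \<in> verts ?D - {tick ?D}"
      using C' collapse_tick_class[OF C C'(2)] by (auto simp: bisim_collapse_def intro: quotientI)
    show "transitions ?D \<subseteq> verts ?D \<times> acts ?D \<times> verts ?D"
      using C'(5) by (auto simp: bisim_collapse_def)
    show "finite (transitions ?D)"
      using T by (rule finite_subset) (use fin C'(4) in auto)
    fix t assume t: "t \<in> transitions ?D"
    show "source t \<noteq> tick ?D"
    proof
      assume s: "source t = tick ?D"
      from t obtain v a v' where "v \<in> source t" "(v, a, v') \<in> transitions C"
        by (auto simp: bisim_collapse_def)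
      with s have "(tick C, v) \<in> bisimilarity C" "(v, a, v') \<in> transitions C"
        by (auto simp: bisim_collapse_def)
      with bisimilarity_step(3) C show False by (fastforce simp: chart_def)
    qed
  next
    fix X assume "X \<in> verts ?D"
    then obtain v where v: "v \<in> verts C" "X = ?q v"
      by (auto simp: bisim_collapse_def elim: quotientE)
    have "(start C, v) \<in> {(u, w). \<exists>a. (u, a, w) \<in> transitions C}\<^sup>*"
      using C v by (auto simp: chart_def)
    then have "(?q (start C), ?q v) \<in> {(u, w). \<exists>a. (u, a, w) \<in> transitions ?D}\<^sup>*"
    proof (induction rule: rtrancl_induct)
      case (step y z)
      then have "(?q y, ?q z) \<in> {(u, w). \<exists>a. (u, a, w) \<in> transitions ?D}"
        using collapse_transition[OF C] by blast
      with step.IH show ?case by (rule rtrancl_into_rtrancl)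
    qed simp
    then show "(start ?D, X) \<in> {(u, w). \<exists>a. (u, a, w) \<in> transitions ?D}\<^sup>*"
      using v by (simp add: bisim_collapse_def)
  qed (use fin in auto)
qed

text \<open>A transition of the collapse is witnessed by some member of the class of
  \<open>u\<close>; bisimilarity passes it on to \<open>u\<close> itself, whichever representative
  \<open>u\<close> is.\<close>

lemma collapse_transition_lift:
  assumes C: "chart C" and "(bisimilarity C `` {u}, a, Y) \<in> transitions (bisim_collapse C)"
  obtains w where "(u, a, w) \<in> transitions C" "w \<in> verts C" "bisimilarity C `` {w} = Y"
proof -
  have eq: "equiv (verts C) (bisimilarity C)" by (rule equiv_bisimilarity[OF C])
  from assms(2) obtain v v' where v: "(u, v) \<in> bisimilarity C" "v' \<in> Y"
    "(v, a, v') \<in> transitions C" and Y: "Y \<in> verts C // bisimilarity C"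
    by (auto simp: bisim_collapse_def)
  from v(1) have "(v, u) \<in> bisimilarity C" using eq by (meson equivE symE)
  from bisimilarity_step(4)[OF this v(3)] obtain w where
    w: "(u, a, w) \<in> transitions C" "(v', w) \<in> bisimilarity C" by blast
  have "bisimilarity C `` {w} = bisimilarity C `` {v'}"
    using equiv_class_eq[OF eq w(2)] by simp
  moreover obtain y where "Y = bisimilarity C `` {y}" using Y by (auto elim: quotientE)
  ultimately have "bisimilarity C `` {w} = Y"
    using v(2) equiv_class_eq[OF eq, of y v'] by auto
  with w bisimilarity_step(2) that show ?thesis by metis
qed

text \<open>Since transitions lift to every representative and the termination class has no vertex
  but \<open>tick C\<close>, preimages of surviving sets survive; a preimage avoids \<open>v\<close>
  when the set avoids the class of \<open>v\<close>.\<close>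

lemma obstruction_lift:
  assumes C: "chart C" and H: "obstruction (bisim_collapse C) H"
  shows "\<exists>H'. obstruction C H'"
proof -
  let ?D = "bisim_collapse C"
  let ?q = "\<lambda>v. bisimilarity C `` {v}"
  define H' where "H' = {(v, a, w). (v, a, w) \<in> transitions C \<and> (?q v, a, ?q w) \<in> H}"
  have HD: "H \<subseteq> transitions ?D" using H by (simp add: obstruction_def)
  have lift: "\<exists>w. (u, a, w) \<in> H' \<and> w \<in> verts C \<and> ?q w = Y" if "(?q u, a, Y) \<in> H" for u a Y
    using that HD collapse_transition_lift[OF C, of u a Y] unfolding H'_def by blast
  have "escapes (tick C) H' v w" if vw: "(v, a, w) \<in> H'" for v a w
  proof -
    from vw have "(?q v, a, ?q w) \<in> H" "w \<in> verts C" using C by (auto simp: H'_def chart_def)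
    moreover from this have "escapes (tick ?D) H (?q v) (?q w)"
      using H by (simp add: obstruction_def)
    ultimately obtain S where "w \<in> verts C" and S: "?q w \<in> S" "?q v \<notin> S" "surviving (tick ?D) H S"
      by (auto simp: escapes_def)
    define S' where "S' = {u \<in> verts C. ?q u \<in> S}"
    have "surviving (tick C) H' S'"
      unfolding surviving_def
    proof
      fix u assume u: "u \<in> S'"
      then consider "?q u = tick ?D" | b Y where "(?q u, b, Y) \<in> H" "Y \<in> S"
        using S(3) by (auto simp: surviving_def S'_def)
      then show "u = tick C \<or> (\<exists>b x. (u, b, x) \<in> H' \<and> x \<in> S')"
      proof cases
        case 1
        then show ?thesis
          using collapse_tick_class[OF C] u by (auto simp: bisim_collapse_def S'_def)
      next
        case 2
        with lift[of u b Y] show ?thesis by (auto simp: S'_def)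
      qed
    qed
    with S \<open>w \<in> verts C\<close> show ?thesis
      unfolding escapes_def by (intro exI[of _ S']) (simp add: S'_def)
  qed
  moreover have "\<exists>S. S \<noteq> {} \<and> perpetual H' S"
  proof -
    from H obtain S where S: "S \<noteq> {}" "perpetual H S" by (auto simp: obstruction_def)
    \<comment> \<open>As the source of a transition, \<open>X\<close> is a class, so the preimage of
      \<open>S\<close> is nonempty.\<close>
    then obtain X a Y where "X \<in> S" "(X, a, Y) \<in> H" by (fastforce simp: perpetual_def)
    with HD have "X \<in> verts C // bisimilarity C" by (auto simp: bisim_collapse_def)
    then obtain u where u: "u \<in> verts C" "?q u \<in> S"
      using \<open>X \<in> S\<close> by (auto elim: quotientE)
    have "perpetual H' {u \<in> verts C. ?q u \<in> S}"
      unfolding perpetual_def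
    proof
      fix u assume "u \<in> {u \<in> verts C. ?q u \<in> S}"
      with S(2) obtain a Y where "(?q u, a, Y) \<in> H" "Y \<in> S" by (auto simp: perpetual_def)
      with lift[of u a Y] show "\<exists>a w. (u, a, w) \<in> H' \<and> w \<in> {u \<in> verts C. ?q u \<in> S}" by auto
    qed
    with u show ?thesis by (intro exI[of _ "{u \<in> verts C. ?q u \<in> S}"]) auto
  qed
  moreover have "H' \<subseteq> transitions C" by (auto simp: H'_def)
  ultimately have "obstruction C H'" by (simp add: obstruction_def)
  then show ?thesis by blast
qed

theorem theorem6p9:
  fixes C :: "('v, 'a) pre_chart"
  assumes "LLEE_chart C"
  shows "LLEE_chart (bisim_collapse C)"
proof -
  from assms obtain L where "chart C" "LLEE_witness C L" by (auto simp: LLEE_chart_def)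
  then show ?thesis
    using no_obstruction_LLEE_chart[OF chart_bisim_collapse] obstruction_lift
      LLEE_witness_no_obstruction by blast
qed

end
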